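(* There is a neighborhood $U\subset\mathbb{C}$ of $1$ with the following property. Let $x,y$ be complex numbers ($y\neq0$) such that the double series \[ A(x,y)=\sum_{n=0}^{\infty} x^n\binom{2n}{n}\sum_{k=0}^n\binom{n}{k}^2\binom{2k}{n}(-1)^k y^{2k-n} \] converges absolutely, and suppose there are $X,Y\in U$ with $X\neq Y$ such that \[ -xy=\left(\frac{X-Y}{4(1+XY)}\right)^2,\qquad 1+\frac{4x}{y}=\left[\frac{(X+Y)(1-XY)}{(X-Y)(1+XY)}\right]^2. \] Then \[ A(x,y)=\frac{1+XY}{2}\,{}_2F_1\!\left(\tfrac12,\tfrac12;1;1-X^2\right)\,{}_2F_1\!\left(\tfrac12,\tfrac12;1;1-Y^2\right). \]
   Context: $\binom{2k}{n}=0$ for $n>2k$; ${}_2F_1$ is the Gauss hypergeometric function. *)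

theory Defs
  imports "HOL-Analysis.Analysis"
begin

text \<open>Summand of the double series A(x,y), indexed by n and k (0 \<le> k \<le> n).
  Binomials of nat vanish for n > 2k, so the possibly negative exponent 2k-n
  is handled with powi (y \<noteq> 0 is assumed in the theorem).\<close>
definition A_term :: "complex \<Rightarrow> complex \<Rightarrow> nat \<Rightarrow> nat \<Rightarrow> complex" where
  "A_term x y n k = x ^ n * of_nat (2*n choose n) * of_nat ((n choose k)^2) *
     of_nat (2*k choose n) * (-1) ^ k * y powi (2 * int k - int n)"

definition A_abs_conv :: "complex \<Rightarrow> complex \<Rightarrow> bool" where
  "A_abs_conv x y \<longleftrightarrow> summable (\<lambda>n. \<Sum>k\<le>n. norm (A_term x y n k))"

definition A_series :: "complex \<Rightarrow> complex \<Rightarrow> complex" where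
  "A_series x y = (\<Sum>n. \<Sum>k\<le>n. A_term x y n k)"

definition hyp2F1 :: "complex \<Rightarrow> complex \<Rightarrow> complex \<Rightarrow> complex \<Rightarrow> complex" where
  "hyp2F1 a b c z = (\<Sum>n. pochhammer a n * pochhammer b n / (pochhammer c n * fact n) * z ^ n)"

end

theory Submission
  imports Defs "HOL-Complex_Analysis.Complex_Analysis"
begin

text \<open>With l + 2 j = n and k = n - j, the series A is a double power series G(w, z) in w = - x y and
  z = - x^2, whose hypergeometric coefficients yield two second order partial differential equations
  for G. On the curve, w = ((X - Y) / (4 (1 + X Y)))^2 and
  z = X Y (1 - X^2) (1 - Y^2) / (16 (1 + X Y)^4) are small near X = Y = 1. For fixed Y, a combination
  of the two equations shows that g(X, Y) = G(w, z) / (1 + X Y) satisfies the same ordinary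
  differential equation in X as F(X) = 2F1(1/2, 1/2; 1; 1 - X^2). Its solution regular at X = 1 is
  unique up to a scalar, so g(X, Y) = g(1, Y) F(X), and since g is symmetric,
  g(1, Y) = g(Y, 1) = g(1, 1) F(Y) = F(Y) / 2.\<close>

section \<open>The differential equation\<close>

text \<open>The equation is that of the complete elliptic integral K as a function of its modulus. K
  of the complementary modulus solves it too, and 2F1(1/2, 1/2; 1; 1 - x^2) is 2/\<pi> times that
  solution. Independent solutions have a logarithm at x = 1, which is why regularity there leaves
  only a scalar. Convergence of the differentiated double series is never estimated. Grouping by the
  weight l + 2 j turns it into a single series of polynomials in w and z. One piece alone does not
  solve the equation, but its defect is a combination of differences of consecutive terms of null
  sequences, so the defects sum to 0; uniform convergence of holomorphic functions carries this over
  to the sum. Constants: a coefficient of weight n is at most 64^n, so |w| \<le> 1/128 and |z| \<le>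
  1/128^2 give majorants 2^(-n) up to polynomial factors, and radius 1/256 around 1 ensures both
  bounds. The final radius may be smaller, to keep F free of zeros.\<close>

definition elliptic_ode_on :: "complex set \<Rightarrow> (complex \<Rightarrow> complex) \<Rightarrow> bool" where
  "elliptic_ode_on S g \<longleftrightarrow> (\<exists>g1 g2. \<forall>x\<in>S.
     (g has_field_derivative g1 x) (at x) \<and> (g1 has_field_derivative g2 x) (at x) \<and>
     x * (1 - x^2) * g2 x + (1 - 3 * x^2) * g1 x - x * g x = 0)"

lemma elliptic_ode_on_subset:
  assumes "elliptic_ode_on S g" "S' \<subseteq> S"
  shows "elliptic_ode_on S' g"
  using assms unfolding elliptic_ode_on_def by blast

text \<open>Uniform limits of holomorphic functions may be differentiated termwise, so a majorant
  for \<open>f n\<close> alone is enough and none for \<open>f1\<close>, \<open>f2\<close> is asked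
  for. The equation is imposed only on the sum of the defects, because the individual summands
  violate it in both applications.\<close>

lemma elliptic_ode_on_suminf:
  fixes f f1 f2 :: "nat \<Rightarrow> complex \<Rightarrow> complex"
  assumes S: "open S"
    and f: "\<And>n x. x \<in> S \<Longrightarrow> (f n has_field_derivative f1 n x) (at x)"
    and f1: "\<And>n x. x \<in> S \<Longrightarrow> (f1 n has_field_derivative f2 n x) (at x)"
    and bound: "\<And>n x. x \<in> S \<Longrightarrow> norm (f n x) \<le> h n" and "summable h"
    and ode: "\<And>x. x \<in> S \<Longrightarrow>
      (\<lambda>n. x * (1 - x^2) * f2 n x + (1 - 3 * x^2) * f1 n x - x * f n x) sums 0"
  shows "elliptic_ode_on S (\<lambda>x. \<Sum>n. f n x)"
proof -
  define g where "g = (\<lambda>x. \<Sum>n. f n x)"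
  define F where "F = (\<lambda>N x. \<Sum>n<N. f n x)"
  have lim: "uniform_limit S F g sequentially"
    unfolding F_def g_def by (rule Weierstrass_m_test[OF bound \<open>summable h\<close>])
  have dF: "(F N has_field_derivative (\<Sum>n<N. f1 n x)) (at x)" if "x \<in> S" for N x
    unfolding F_def by (rule DERIV_sum) (use f that in auto)
  have dF1: "((\<lambda>x. \<Sum>n<N. f1 n x) has_field_derivative (\<Sum>n<N. f2 n x)) (at x)"
    if "x \<in> S" for N x
    by (rule DERIV_sum) (use f1 that in auto)
  have hol: "F N holomorphic_on S" for N
    using dF S by (meson holomorphic_onI field_differentiable_at_within field_differentiable_def)
  have D1: "deriv (F N) x = (\<Sum>n<N. f1 n x)" if "x \<in> S" for N x
    using dF[OF that] by (rule DERIV_imp_deriv)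
  have D2: "deriv (deriv (F N)) x = (\<Sum>n<N. f2 n x)" if "x \<in> S" for N x
  proof (rule DERIV_imp_deriv)
    show "(deriv (F N) has_field_derivative (\<Sum>n<N. f2 n x)) (at x)"
      using has_field_derivative_transform_within_open[OF dF1[OF that] S that] D1 by simp
  qed
  have L: "(\<lambda>N. (deriv ^^ m) (F N) x) \<longlonglongrightarrow> (deriv ^^ m) g x" if "x \<in> S" for m x
    by (rule higher_deriv_complex_uniform_limit[OF lim _ _ S that]) (auto simp: hol)
  have holg: "g holomorphic_on S"
  proof (rule holomorphic_uniform_sequence[OF S hol])
    fix x assume "x \<in> S"
    then obtain d where d: "d > 0" "cball x d \<subseteq> S" using S open_contains_cball by blast
    then show "\<exists>d>0. cball x d \<subseteq> S \<and> uniform_limit (cball x d) F g sequentially"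
      using uniform_limit_on_subset[OF lim] by blast
  qed
  have s1: "(\<lambda>n. f1 n x) sums deriv g x" if "x \<in> S" for x
    using L[OF that, of 1] D1[OF that] by (simp add: sums_def)
  have s2: "(\<lambda>n. f2 n x) sums deriv (deriv g) x" if "x \<in> S" for x
    using L[OF that, of 2] D2[OF that] by (simp add: sums_def eval_nat_numeral)
  have s0: "(\<lambda>n. f n x) sums g x" if "x \<in> S" for x
    using L[OF that, of 0] by (simp add: sums_def F_def)
  have "(g has_field_derivative deriv g x) (at x)" if "x \<in> S" for x
    using holg S that holomorphic_derivI by blast
  moreover have "(deriv g has_field_derivative deriv (deriv g) x) (at x)" if "x \<in> S" for x
    using holomorphic_deriv[OF holg S] S that holomorphic_derivI by blast
  moreover have "x * (1 - x^2) * deriv (deriv g) x + (1 - 3 * x^2) * deriv g x - x * g x = 0"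
    if "x \<in> S" for x
    \<comment> \<open>The same series is summed twice: termwise through \<open>s2\<close>,
      \<open>s1\<close>, \<open>s0\<close>, and to 0 by \<open>ode\<close>.\<close>
    using sums_unique2[OF sums_diff[OF sums_add[OF sums_mult[OF s2] sums_mult[OF s1]]
        sums_mult[OF s0]] ode, OF that that that that] .
  ultimately show ?thesis unfolding elliptic_ode_on_def g_def[symmetric] by blast
qed

text \<open>The equation says that x (1 - x^2) times the Wronskian of two solutions is constant; its
  value at the singular point 1 is 0.\<close>

lemma elliptic_ode_on_proportional:
  assumes S: "open S" "convex S" "1 \<in> S" "0 \<notin> S" "-1 \<notin> S"
    and g: "elliptic_ode_on S g" and f: "elliptic_ode_on S f"
    and nz: "\<And>x. x \<in> S \<Longrightarrow> f x \<noteq> 0" and x: "x \<in> S"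
  shows "g x * f 1 = g 1 * f x"
proof -
  obtain g1 g2 where g: "\<And>x. x \<in> S \<Longrightarrow> (g has_field_derivative g1 x) (at x)"
     "\<And>x. x \<in> S \<Longrightarrow> (g1 has_field_derivative g2 x) (at x)"
     "\<And>x. x \<in> S \<Longrightarrow> x * (1 - x^2) * g2 x + (1 - 3 * x^2) * g1 x - x * g x = 0"
    using g unfolding elliptic_ode_on_def by blast
  obtain f1 f2 where f: "\<And>x. x \<in> S \<Longrightarrow> (f has_field_derivative f1 x) (at x)"
     "\<And>x. x \<in> S \<Longrightarrow> (f1 has_field_derivative f2 x) (at x)"
     "\<And>x. x \<in> S \<Longrightarrow> x * (1 - x^2) * f2 x + (1 - 3 * x^2) * f1 x - x * f x = 0"
    using f unfolding elliptic_ode_on_def by blast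
  define W where "W = (\<lambda>x. g1 x * f x - g x * f1 x)"
  have "((\<lambda>x. x * (1 - x^2) * W x) has_field_derivative 0) (at x within S)" if "x \<in> S" for x
  proof -
    have "((\<lambda>x. x * (1 - x^2) * W x) has_field_derivative
        (1 - 3 * x^2) * (g1 x * f x - g x * f1 x) + x * (1 - x^2) * (g2 x * f x - g x * f2 x)) (at x)"
      unfolding W_def
      by (rule derivative_eq_intros g f that refl | simp)+
         (simp add: algebra_simps power2_eq_square power3_eq_cube)
    moreover have "(1 - 3 * x^2) * (g1 x * f x - g x * f1 x) + x * (1 - x^2) * (g2 x * f x - g x * f2 x)
       = f x * (x * (1 - x^2) * g2 x + (1 - 3 * x^2) * g1 x - x * g x)
       - g x * (x * (1 - x^2) * f2 x + (1 - 3 * x^2) * f1 x - x * f x)"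
      by (simp add: algebra_simps)
    ultimately show ?thesis
      using g(3)[OF that] f(3)[OF that] by (simp add: has_field_derivative_at_within)
  qed
  from has_field_derivative_zero_constant[OF S(2) this]
  obtain c where c: "\<And>x. x \<in> S \<Longrightarrow> x * (1 - x^2) * W x = c" by blast
  have "c = 0" using c[OF S(3)] by simp
  have W0: "W x = 0" if "x \<in> S" for x
  proof (cases "x = 1")
    case True
    \<comment> \<open>At the singular point the constancy of x (1 - x^2) W gives no information on W
      itself. There the equation loses its leading term and ties each value to the first derivative,
      so the Wronskian vanishes directly.\<close>
    have "g 1 = - 2 * g1 1" "f 1 = - 2 * f1 1"
      using g(3)[OF S(3)] f(3)[OF S(3)] by simp_all
    then show ?thesis using True unfolding W_def by simp
  next
    case False
    moreover have "x \<noteq> 0" "x \<noteq> -1" using that S by auto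
    ultimately have "x * (1 - x^2) \<noteq> 0" by (auto simp: power2_eq_1_iff)
    then show ?thesis using c[OF that] \<open>c = 0\<close> by simp
  qed
  have "((\<lambda>x. g x / f x) has_field_derivative 0) (at x within S)" if "x \<in> S" for x
  proof -
    have "((\<lambda>x. g x / f x) has_field_derivative (g1 x * f x - g x * f1 x) / (f x * f x)) (at x)"
      by (rule derivative_eq_intros g f that nz refl)+
    then show ?thesis using W0[OF that] by (simp add: W_def has_field_derivative_at_within)
  qed
  from has_field_derivative_zero_constant[OF S(2) this]
  obtain c' where c': "\<And>x. x \<in> S \<Longrightarrow> g x / f x = c'" by blast
  show ?thesis using c'[OF x] c'[OF S(3)] nz[OF x] nz[OF S(3)] by (simp add: field_simps)
qed

section \<open>The elliptic integral\<close>

text \<open>Equal to (binom(2n, n) / 4^n)^2, the Taylor coefficients of 2/\<pi> times K in the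
  square of the modulus.\<close>

definition ell_coeff :: "nat \<Rightarrow> complex" where
  "ell_coeff n = (pochhammer (1/2) n / fact n)^2"

lemma ell_coeff_Suc: "of_nat (Suc n)^2 * ell_coeff (Suc n) = (of_nat n + 1/2)^2 * ell_coeff n"
  unfolding ell_coeff_def pochhammer_Suc fact_Suc
  by (simp add: field_simps power2_eq_square del: of_nat_Suc)

lemma norm_ell_coeff_le: "norm (ell_coeff n) \<le> 1"
proof -
  have "norm (pochhammer (1/2) n :: complex) \<le> fact n"
  proof (induction n)
    case (Suc n)
    have "norm (1/2 + of_nat n :: complex) \<le> real (Suc n)"
      by (rule norm_triangle_le) simp
    then have "norm (pochhammer (1/2) n :: complex) * norm (1/2 + of_nat n :: complex)
       \<le> fact n * real (Suc n)"
      using Suc by (intro mult_mono) auto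
    then show ?case unfolding pochhammer_Suc norm_mult by (simp add: algebra_simps)
  qed simp
  then have "norm (pochhammer (1/2) n / fact n :: complex) \<le> 1"
    by (simp add: norm_divide)
  then show ?thesis unfolding ell_coeff_def norm_power by (simp add: power_le_one)
qed

lemma hyp2F1_half: "hyp2F1 (1/2) (1/2) 1 t = (\<Sum>n. ell_coeff n * t ^ n)"
  unfolding hyp2F1_def ell_coeff_def
  by (simp add: pochhammer_fact[symmetric] power2_eq_square)

text \<open>The cube is chosen for the telescoping terms of the double series: a factor quadratic in
  n from two differentiations, times at most n + 1 summands of weight n.\<close>

lemma tendsto_poly_times_power:
  fixes C :: real
  shows "(\<lambda>n. C * real (n+1) ^ 3 * (1/2) ^ n) \<longlonglongrightarrow> 0"
  by real_asymp

lemma summable_poly_times_power: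
  shows "summable (\<lambda>n. real (n+1) * (1/2) ^ n)"
  by (rule summable_comparison_test_bigo[of "\<lambda>n. (3/4::real) ^ n"]) (simp, real_asymp)

text \<open>In the variable t = 1 - x^2 the operator is a difference of two Euler-type operators,
  and the coefficient recurrence makes one of them a shift of the other, so the defects telescope.
  Radius 1/8 gives |t| \<le> 3/8, within the majorant (1/2)^n.\<close>

lemma elliptic_ode_on_hyp2F1:
  assumes "S \<subseteq> ball 1 (1/8)" "open S"
  shows "elliptic_ode_on S (\<lambda>x. hyp2F1 (1/2) (1/2) 1 (1 - x^2))"
  unfolding hyp2F1_half
proof (rule elliptic_ode_on_suminf[where h = "\<lambda>n. (1/2)^n"])
  fix n :: nat and x :: complex
  show "((\<lambda>x. ell_coeff n * (1 - x^2) ^ n) has_field_derivative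
      - 2 * ell_coeff n * (of_nat n * (1 - x^2) ^ (n - 1)) * x) (at x)"
    by (auto intro!: derivative_eq_intros)
  show "((\<lambda>x. - 2 * ell_coeff n * (of_nat n * (1 - x^2) ^ (n - 1)) * x) has_field_derivative
      4 * ell_coeff n * (of_nat n * of_nat (n - 1) * (1 - x^2) ^ (n - 2)) * x^2
      - 2 * ell_coeff n * (of_nat n * (1 - x^2) ^ (n - 1))) (at x)"
    by (auto intro!: derivative_eq_intros simp: algebra_simps power2_eq_square numeral_2_eq_2)
next
  fix n :: nat and x :: complex assume x: "x \<in> S"
  define t where "t = 1 - x^2"
  have t: "norm t \<le> 1/2"
  proof -
    have "norm (x - 1) \<le> 1/8" using x assms by (auto simp: dist_norm norm_minus_commute)
    moreover have "norm (x + 1) \<le> norm (x - 1) + norm (2::complex)"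
      using norm_triangle_ineq[of "x - 1" 2] by (simp add: add.commute)
    ultimately have "norm (x - 1) * norm (x + 1) \<le> 1/8 * 3" by (intro mult_mono) auto
    moreover have "norm t = norm (x - 1) * norm (x + 1)"
      unfolding t_def norm_mult[symmetric] norm_minus_commute[of 1]
      by (simp add: algebra_simps power2_eq_square)
    ultimately show ?thesis by simp
  qed
  have "norm (ell_coeff n) * norm t ^ n \<le> 1 * (1/2)^n"
    by (intro mult_mono power_mono norm_ell_coeff_le t) auto
  then show "norm (ell_coeff n * (1 - x^2) ^ n) \<le> (1/2)^n"
    by (simp add: norm_mult norm_power t_def)
  \<comment> \<open>\<open>E n\<close> is (d/dt) t (d/dt) applied to the term
    \<open>ell_coeff n * t ^ n\<close>; by \<open>ES\<close>, \<open>E (Suc n)\<close> is (t d/dt +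
    1/2)^2 applied to the same term. The factor n^2 makes \<open>E 0\<close> vanish despite the
    truncated exponent.\<close>
  define E where "E = (\<lambda>n. ell_coeff n * of_nat n ^ 2 * t ^ (n - 1))"
  have ES: "E (Suc n) = ell_coeff n * (of_nat n + 1/2)^2 * t ^ n" for n
    using ell_coeff_Suc[of n] by (simp add: E_def algebra_simps)
  have "E \<longlonglongrightarrow> 0"
  proof (rule Lim_null_comparison[OF _ tendsto_poly_times_power[of 2]], rule always_eventually, rule allI)
    fix n
    show "norm (E n) \<le> 2 * real (n+1) ^ 3 * (1/2) ^ n"
    proof (cases n)
      case 0 then show ?thesis by (simp add: E_def)
    next
      case (Suc m)
      have "norm (E n) = norm (ell_coeff n) * (real n ^ 2 * norm t ^ m)"
        using Suc by (simp add: E_def norm_mult norm_power del: of_nat_Suc)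
      also have "\<dots> \<le> 1 * (real (n+1) ^ 3 * (1/2) ^ m)"
      proof (intro mult_mono power_mono norm_ell_coeff_le t)
        have "real n ^ 2 \<le> real (n+1) ^ 2" by (intro power_mono) auto
        also have "\<dots> \<le> real (n+1) ^ 3" by (intro power_increasing) auto
        finally show "real n ^ 2 \<le> real (n+1) ^ 3" .
      qed auto
      finally show ?thesis using Suc by simp
    qed
  qed
  then have "(\<lambda>n. E (Suc n) - E n) sums 0"
    using telescope_sums[of E 0] by (simp add: E_def)
  then have "(\<lambda>n. - 4 * x * (E (Suc n) - E n)) sums 0"
    using sums_mult[of _ 0 "- 4 * x"] by simp
  moreover have "x * (1 - x^2) * (4 * ell_coeff n * (of_nat n * of_nat (n - 1) * (1 - x^2) ^ (n - 2)) * x^2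
      - 2 * ell_coeff n * (of_nat n * (1 - x^2) ^ (n - 1)))
      + (1 - 3 * x^2) * (- 2 * ell_coeff n * (of_nat n * (1 - x^2) ^ (n - 1)) * x)
      - x * (ell_coeff n * (1 - x^2) ^ n) = - 4 * x * (E (Suc n) - E n)" for n
  proof -
    have x2: "x^2 = 1 - t" by (simp add: t_def)
    consider "n = 0" | "n = 1" | m where "n = m + 2"
      by (metis One_nat_def add_2_eq_Suc' not0_implies_Suc)
    then show ?thesis
    proof cases
      case 1 then show ?thesis unfolding ES by (simp add: E_def power2_eq_square)
    next
      case 2 then show ?thesis unfolding ES x2 by (simp add: E_def power2_eq_square algebra_simps)
    next
      case (3 m) then show ?thesis unfolding ES x2 unfolding E_def
        by (simp add: power2_eq_square algebra_simps)
    qed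
  qed
  ultimately show "(\<lambda>n. x * (1 - x^2) * (4 * ell_coeff n * (of_nat n * of_nat (n - 1) * (1 - x^2) ^ (n - 2)) * x^2
      - 2 * ell_coeff n * (of_nat n * (1 - x^2) ^ (n - 1)))
      + (1 - 3 * x^2) * (- 2 * ell_coeff n * (of_nat n * (1 - x^2) ^ (n - 1)) * x)
      - x * (ell_coeff n * (1 - x^2) ^ n)) sums 0" by simp
qed (use assms in \<open>auto intro: summable_geometric\<close>)

section \<open>The double series\<close>

text \<open>The product of the three binomials of A for n = l + 2 j, k = l + j, after cancellation.
  In this form the quotients of neighbouring coefficients are visibly rational in l and j.\<close>

definition wz_coeff :: "nat \<Rightarrow> nat \<Rightarrow> complex" where
  "wz_coeff l j = fact (4*j + 2*l) * fact (2*j + 2*l) / (fact (j + l)^2 * fact j^2 * fact (2*j + l) * fact l)"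

lemma wz_coeff_Suc_left:
  "of_nat (Suc l) * of_nat (j + Suc l) * wz_coeff (Suc l) j =
   4 * of_nat (4*j + 2*l + 1) * of_nat (2*j + 2*l + 1) * wz_coeff l j"
proof -
  have nz: "(of_nat (Suc l) :: complex) \<noteq> 0" "(of_nat (Suc (j + l)) :: complex) \<noteq> 0"
    "(of_nat (Suc (2*j + l)) :: complex) \<noteq> 0"
    by (simp_all only: of_nat_eq_0_iff)
  have e: "4*j + 2*Suc l = Suc (Suc (4*j + 2*l))" "2*j + 2*Suc l = Suc (Suc (2*j + 2*l))" by auto
  have d: "of_nat (Suc (Suc (4*j + 2*l))) = (2 * of_nat (Suc (2*j + l)) :: complex)"
    "of_nat (Suc (Suc (2*j + 2*l))) = (2 * of_nat (Suc (j + l)) :: complex)" by auto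
  show ?thesis
    unfolding wz_coeff_def e add_Suc_right fact_Suc d
    using nz by (simp add: divide_simps power2_eq_square del: of_nat_Suc)
qed

text \<open>Trading one w for one z raises the weight by one, just as adding one w does. Raising j
  alone would give a quotient with cubic numerator and denominator, hence a third order operator;
  this mixed step stays at second order.\<close>

lemma wz_coeff_Suc_right:
  "of_nat (Suc j)^2 * wz_coeff l (Suc j) = 2 * of_nat (4*j + 2*l + 3) * of_nat (Suc l) * wz_coeff (Suc l) j"
proof -
  have nz: "(of_nat (Suc l) :: complex) \<noteq> 0" "(of_nat (Suc j) :: complex) \<noteq> 0"
    "(of_nat (Suc (Suc (2*j + l))) :: complex) \<noteq> 0"
    by (simp_all only: of_nat_eq_0_iff)
  have e: "4*Suc j + 2*l = Suc (Suc (4*j + 2*Suc l))" "2*Suc j + 2*l = 2*j + 2*Suc l"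
    "Suc j + l = j + Suc l" "2*Suc j + l = Suc (2*j + Suc l)" by auto
  have d: "of_nat (Suc (Suc (4*j + 2*Suc l))) = (2 * of_nat (Suc (2*j + Suc l)) :: complex)"
    "Suc (4*j + 2*Suc l) = 4*j + 2*l + 3" by auto
  have nz': "(of_nat (Suc (2*j + Suc l)) :: complex) \<noteq> 0"
    by (simp only: of_nat_eq_0_iff)
  show ?thesis
    unfolding wz_coeff_def e fact_Suc[of "Suc (4*j + 2*Suc l)"] fact_Suc[of "4*j + 2*Suc l"] fact_Suc[of j]
      fact_Suc[of l] fact_Suc[of "2*j + Suc l"]
    unfolding d
    using nz nz' by (simp add: divide_simps power2_eq_square del: of_nat_Suc fact_Suc)
      (simp add: algebra_simps)
qed

lemma wz_coeff_binomial:
  "wz_coeff l j = of_nat ((2*(l + 2*j)) choose (l + 2*j)) * of_nat (((l + 2*j) choose j)^2) *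
     of_nat ((2*(l + j)) choose (l + 2*j))"
proof -
  have "2*(l + 2*j) - (l + 2*j) = l + 2*j" "l + 2*j - j = l + j" "2*(l + j) - (l + 2*j) = l" by auto
  then show ?thesis
    unfolding wz_coeff_def of_nat_power
    by (simp add: binomial_fact field_simps power2_eq_square)
qed

text \<open>Each of the three binomial factors is at most 4^n for n = l + 2 j.\<close>

lemma norm_wz_coeff_le: "norm (wz_coeff l j) \<le> 64 ^ (l + 2*j)"
proof -
  define n where "n = l + 2*j"
  have "(2*n choose n) * (n choose j)^2 * (2*(l+j) choose n) \<le> 2^(2*n) * (2^n)^2 * 2^(2*n)"
  proof (intro mult_mono power_mono binomial_le_pow2)
    have "2*(l+j) choose n \<le> 2^(2*(l+j))" by (rule binomial_le_pow2)
    also have "\<dots> \<le> 2^(2*n)" unfolding n_def by (intro power_increasing) auto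
    finally show "2*(l+j) choose n \<le> 2^(2*n)" .
  qed auto
  also have "\<dots> = (64::nat)^n" by (simp add: power_mult power2_eq_square flip: power_mult_distrib)
  finally have "real ((2*n choose n) * (n choose j)^2 * (2*(l+j) choose n)) \<le> 64^n"
    by (metis of_nat_le_iff of_nat_numeral of_nat_power)
  moreover have "norm (wz_coeff l j) = real ((2*n choose n) * (n choose j)^2 * (2*(l+j) choose n))"
    unfolding wz_coeff_binomial n_def by (simp only: norm_mult norm_of_nat of_nat_mult)
  ultimately show ?thesis by (simp add: n_def)
qed

section \<open>Sums graded by weight, the power of x carried by a monomial in w = - x y and z = -
  x^2\<close>

definition weight_sum :: "(nat \<Rightarrow> nat \<Rightarrow> complex) \<Rightarrow> nat \<Rightarrow> complex" where
  "weight_sum F n = (\<Sum>j\<le>n div 2. F (n - 2*j) j)"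

lemma weight_sum_cong: "(\<And>l j. F l j = G l j) \<Longrightarrow> weight_sum F n = weight_sum G n"
  unfolding weight_sum_def by (rule sum.cong) auto

lemma weight_sum_add: "weight_sum F n + weight_sum G n = weight_sum (\<lambda>l j. F l j + G l j) n"
  by (simp add: weight_sum_def sum.distrib)

lemma weight_sum_mult: "c * weight_sum F n = weight_sum (\<lambda>l j. c * F l j) n"
  by (simp add: weight_sum_def sum_distrib_left)

lemma weight_sum_Suc_left:
  assumes "\<And>j. F 0 j = 0"
  shows "weight_sum F (Suc n) = weight_sum (\<lambda>l j. F (Suc l) j) n"
proof -
  have "weight_sum F (Suc n) = (\<Sum>j\<le>n div 2. F (Suc n - 2*j) j)"
    unfolding weight_sum_def
  proof (rule sum.mono_neutral_right)
    show "\<forall>j\<in>{..Suc n div 2} - {..n div 2}. F (Suc n - 2*j) j = 0"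
    proof
      \<comment> \<open>An extra index occurs only when n + 1 is even, and its term has l =
        0.\<close>
      fix j assume "j \<in> {..Suc n div 2} - {..n div 2}"
      then have "Suc n - 2*j = 0" by auto
      then show "F (Suc n - 2*j) j = 0" using assms by simp
    qed
  qed auto
  also have "\<dots> = weight_sum (\<lambda>l j. F (Suc l) j) n"
    unfolding weight_sum_def
  proof (rule sum.cong)
    fix j assume "j \<in> {..n div 2}"
    then have "Suc n - 2*j = Suc (n - 2*j)" by auto
    then show "F (Suc n - 2*j) j = F (Suc (n - 2*j)) j" by simp
  qed simp
  finally show ?thesis .
qed

lemma weight_sum_Suc_right:
  assumes "\<And>l. F l 0 = 0"
  shows "weight_sum F (Suc (Suc n)) = weight_sum (\<lambda>l j. F l (Suc j)) n"
proof -
  have "weight_sum F (Suc (Suc n)) = (\<Sum>j\<le>Suc (n div 2). F (Suc (Suc n) - 2*j) j)"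
    by (simp add: weight_sum_def)
  also have "\<dots> = (\<Sum>j\<le>n div 2. F (Suc (Suc n) - 2*Suc j) (Suc j))"
    by (subst sum.atMost_Suc_shift) (simp add: assms)
  finally show ?thesis by (simp add: weight_sum_def)
qed

lemma norm_weight_sum_le:
  assumes "\<And>l j. l + 2*j = n \<Longrightarrow> norm (F l j) \<le> B"
  shows "norm (weight_sum F n) \<le> real (n+1) * B"
proof -
  have B: "0 \<le> B" using order_trans[OF norm_ge_zero assms[of n 0]] by simp
  have "norm (weight_sum F n) \<le> (\<Sum>j\<le>n div 2. B)"
    unfolding weight_sum_def by (rule sum_norm_le) (auto intro: assms)
  also have "\<dots> = real (n div 2 + 1) * B" by simp
  also have "\<dots> \<le> real (n+1) * B" using B by (intro mult_right_mono) auto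
  finally show ?thesis .
qed

text \<open>The a-th derivative of w^l, written without negative exponents: for a > l the recursion
  meets a factor 0, so the truncated \<open>l - 1\<close> does no harm.\<close>

primrec monom_deriv :: "nat \<Rightarrow> nat \<Rightarrow> complex \<Rightarrow> complex" where
  "monom_deriv 0 l w = w ^ l"
| "monom_deriv (Suc a) l w = of_nat l * monom_deriv a (l - 1) w"

lemma has_field_derivative_monom_deriv:
  "(monom_deriv a l has_field_derivative monom_deriv (Suc a) l w) (at w)"
proof (induction a arbitrary: l)
  case 0
  have "((\<lambda>w. w ^ l) has_field_derivative of_nat l * w ^ (l - 1)) (at w)"
    by (auto intro!: derivative_eq_intros)
  then show ?case by simp
next
  case (Suc a)
  have "((\<lambda>w. of_nat l * monom_deriv a (l - 1) w) has_field_derivative of_nat l * monom_deriv (Suc a) (l - 1) w) (at w)"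
    by (rule DERIV_cmult[OF Suc])
  then show ?case by simp
qed

text \<open>Euler operators act on monomials as polynomials in l. The middle form keeps one
  derivative because the telescoping operators contain w d^2/dw^2 and z d^2/dz^2 with a single power
  in front.\<close>

lemma monom_deriv_euler:
  "w * monom_deriv 1 l w = of_nat l * w ^ l"
  "w * monom_deriv 2 l w = (of_nat l - 1) * monom_deriv 1 l w"
  "w^2 * monom_deriv 2 l w = of_nat l * (of_nat l - 1) * w ^ l"
proof -
  consider "l = 0" | "l = 1" | m where "l = m + 2"
    by (metis One_nat_def add_2_eq_Suc' not0_implies_Suc)
  then show "w * monom_deriv 1 l w = of_nat l * w ^ l"
    "w * monom_deriv 2 l w = (of_nat l - 1) * monom_deriv 1 l w"
    "w^2 * monom_deriv 2 l w = of_nat l * (of_nat l - 1) * w ^ l"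
    by (cases; simp add: eval_nat_numeral algebra_simps)+
qed

text \<open>The part of weight n of the a-th w-derivative and b-th z-derivative of the double series;
  terms are counted by their weight before differentiation.\<close>

definition wz_part :: "nat \<Rightarrow> nat \<Rightarrow> nat \<Rightarrow> complex \<Rightarrow> complex \<Rightarrow> complex" where
  "wz_part a b n w z = weight_sum (\<lambda>l j. wz_coeff l j * monom_deriv a l w * monom_deriv b j z) n"

lemma has_field_derivative_wz_part:
  assumes "(w has_field_derivative w') (at x)" "(z has_field_derivative z') (at x)"
  shows "((\<lambda>x. wz_part a b n (w x) (z x)) has_field_derivative
    w' * wz_part (Suc a) b n (w x) (z x) + z' * wz_part a (Suc b) n (w x) (z x)) (at x)"
proof -
  have 1: "((\<lambda>x. monom_deriv a l (w x)) has_field_derivative monom_deriv (Suc a) l (w x) * w') (at x)" for a l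
    by (rule DERIV_chain2[OF has_field_derivative_monom_deriv assms(1)])
  have 2: "((\<lambda>x. monom_deriv a l (z x)) has_field_derivative monom_deriv (Suc a) l (z x) * z') (at x)" for a l
    by (rule DERIV_chain2[OF has_field_derivative_monom_deriv assms(2)])
  have "((\<lambda>x. wz_coeff l j * monom_deriv a l (w x) * monom_deriv b j (z x)) has_field_derivative
     w' * (wz_coeff l j * monom_deriv (Suc a) l (w x) * monom_deriv b j (z x)) +
     z' * (wz_coeff l j * monom_deriv a l (w x) * monom_deriv (Suc b) j (z x))) (at x)" for l j
    by (rule derivative_eq_intros 1 2 refl)+ (simp add: algebra_simps)
  then show ?thesis
    unfolding wz_part_def weight_sum_mult weight_sum_add unfolding weight_sum_def by (intro DERIV_sum)
qed

text \<open>Telescoping of the following two sums expresses that the double series is annihilated by two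
  partial differential operators of second order.\<close>

definition tele_w :: "complex \<Rightarrow> complex \<Rightarrow> nat \<Rightarrow> complex" where
  "tele_w w z n = w * wz_part 2 0 n w z + wz_part 1 0 n w z + z * wz_part 1 1 n w z"

definition tele_z :: "complex \<Rightarrow> complex \<Rightarrow> nat \<Rightarrow> complex" where
  "tele_z w z n = z * wz_part 0 2 n w z + wz_part 0 1 n w z"

text \<open>The operator is d/dw composed with w d/dw + z d/dz, hence the factor l (j + l) on each
  monomial.\<close>

lemma tele_w_eq: "tele_w w z = weight_sum (\<lambda>l j. of_nat l * of_nat (j + l) * wz_coeff l j * w ^ (l - 1) * z ^ j)"
proof
  fix n
  have "tele_w w z n = weight_sum (\<lambda>l j. wz_coeff l j * (w * monom_deriv 2 l w + monom_deriv 1 l w) * z ^ j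
      + wz_coeff l j * monom_deriv 1 l w * (z * monom_deriv 1 j z)) n"
    unfolding tele_w_def wz_part_def weight_sum_mult weight_sum_add by (rule weight_sum_cong) (simp add: algebra_simps)
  also have "\<dots> = weight_sum (\<lambda>l j. of_nat l * of_nat (j + l) * wz_coeff l j * w ^ (l - 1) * z ^ j) n"
    by (rule weight_sum_cong, unfold monom_deriv_euler) (simp add: algebra_simps)
  finally show "tele_w w z n = \<dots>" .
qed

text \<open>Here the operator is (d/dz) z (d/dz), hence the factor j^2.\<close>

lemma tele_z_eq: "tele_z w z = weight_sum (\<lambda>l j. of_nat j^2 * wz_coeff l j * w ^ l * z ^ (j - 1))"
proof
  fix n
  have "tele_z w z n = weight_sum (\<lambda>l j. wz_coeff l j * w ^ l * (z * monom_deriv 2 j z + monom_deriv 1 j z)) n"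
    unfolding tele_z_def wz_part_def weight_sum_mult weight_sum_add by (rule weight_sum_cong) (simp add: algebra_simps)
  also have "\<dots> = weight_sum (\<lambda>l j. of_nat j^2 * wz_coeff l j * w ^ l * z ^ (j - 1)) n"
    by (rule weight_sum_cong, unfold monom_deriv_euler) (simp add: algebra_simps power2_eq_square)
  finally show "tele_z w z n = \<dots>" .
qed

text \<open>The recurrence in l rewrites the part of weight n + 1 over the monomials of weight n,
  with factor 4 (4j + 2l + 1)(2j + 2l + 1). Expanding this in l, l (l - 1), j, j (j - 1) and j l
  produces the numerical coefficients.\<close>

lemma tele_w_Suc:
  "tele_w w z (Suc n) = 32 * z^2 * wz_part 0 2 n w z + 48 * w * z * wz_part 1 1 n w z + 16 * w^2 * wz_part 2 0 n w z
     + 56 * z * wz_part 0 1 n w z + 32 * w * wz_part 1 0 n w z + 4 * wz_part 0 0 n w z"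
proof -
  have "tele_w w z (Suc n) = weight_sum (\<lambda>l j. (of_nat (Suc l) * of_nat (j + Suc l) * wz_coeff (Suc l) j) * w ^ l * z ^ j) n"
    unfolding tele_w_eq by (subst weight_sum_Suc_left) simp_all
  also have "\<dots> = weight_sum (\<lambda>l j. 32 * (wz_coeff l j * w ^ l * (z^2 * monom_deriv 2 j z))
      + 48 * (wz_coeff l j * (w * monom_deriv 1 l w) * (z * monom_deriv 1 j z)) + 16 * (wz_coeff l j * (w^2 * monom_deriv 2 l w) * z ^ j)
      + 56 * (wz_coeff l j * w ^ l * (z * monom_deriv 1 j z)) + 32 * (wz_coeff l j * (w * monom_deriv 1 l w) * z ^ j)
      + 4 * (wz_coeff l j * w ^ l * z ^ j)) n"
    by (rule weight_sum_cong, unfold monom_deriv_euler wz_coeff_Suc_left) (simp add: algebra_simps)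
  also have "\<dots> = 32 * z^2 * wz_part 0 2 n w z + 48 * w * z * wz_part 1 1 n w z + 16 * w^2 * wz_part 2 0 n w z
     + 56 * z * wz_part 0 1 n w z + 32 * w * wz_part 1 0 n w z + 4 * wz_part 0 0 n w z"
    unfolding wz_part_def weight_sum_mult weight_sum_add by (rule weight_sum_cong) (simp add: algebra_simps)
  finally show ?thesis .
qed

text \<open>The mixed recurrence gives the factor 2 (4j + 2l + 1) l after l is shifted back by one;
  it expands as 8 j l + 4 l (l - 1) + 6 l.\<close>

lemma tele_z_Suc:
  "tele_z w z (Suc n) = 8 * z * wz_part 1 1 n w z + 4 * w * wz_part 2 0 n w z + 6 * wz_part 1 0 n w z"
proof -
  define H where "H = (\<lambda>l j. 2 * (of_nat (4*j + 2*l + 1) * of_nat l * wz_coeff l j) * w ^ (l - 1) * z ^ j)"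
  have "tele_z w z (Suc n) = weight_sum H n"
  \<comment> \<open>The shift in j lowers the weight by two and so needs n \<ge> 1. For n = 0 both
    sides are 0: weight 1 contains no z, and \<open>H\<close> vanishes at l = 0.\<close>
  proof (cases n)
    case 0
    then show ?thesis by (simp add: tele_z_eq weight_sum_def H_def)
  next
    case (Suc m)
    have "tele_z w z (Suc n) = weight_sum (\<lambda>l j. (of_nat (Suc j)^2 * wz_coeff l (Suc j)) * w ^ l * z ^ j) m"
      unfolding tele_z_eq Suc by (subst weight_sum_Suc_right) simp_all
    also have "\<dots> = weight_sum (\<lambda>l j. H (Suc l) j) m"
      by (rule weight_sum_cong, unfold wz_coeff_Suc_right) (simp add: H_def algebra_simps)
    also have "\<dots> = weight_sum H n"
      unfolding Suc by (subst weight_sum_Suc_left) (simp_all add: H_def)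
    finally show ?thesis .
  qed
  also have "weight_sum H n = weight_sum (\<lambda>l j. 8 * (wz_coeff l j * monom_deriv 1 l w * (z * monom_deriv 1 j z))
      + 4 * (wz_coeff l j * (w * monom_deriv 2 l w) * z ^ j) + 6 * (wz_coeff l j * monom_deriv 1 l w * z ^ j)) n"
    by (rule weight_sum_cong, unfold monom_deriv_euler) (simp add: H_def algebra_simps)
  also have "\<dots> = 8 * z * wz_part 1 1 n w z + 4 * w * wz_part 2 0 n w z + 6 * wz_part 1 0 n w z"
    unfolding wz_part_def weight_sum_mult weight_sum_add by (rule weight_sum_cong) (simp add: algebra_simps)
  finally show ?thesis .
qed

text \<open>The bounds 1/128 and (1/128)^2 on w and z match their weights 1 and 2. Losing one power
  of w or z to a differentiation costs a factor 128 or 128^2; a truncated exponent at 0 respects the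
  same bound.\<close>

lemma norm_term_le:
  fixes w z :: complex
  assumes w: "norm w \<le> 1/128" and z: "norm z \<le> (1/128)^2" and n: "l + 2*j = n"
  shows "norm (wz_coeff l j) * norm w ^ l * norm z ^ j \<le> (1/2)^n"
    and "norm (wz_coeff l j) * norm w ^ (l-1) * norm z ^ j \<le> 128 * (1/2)^n"
    and "norm (wz_coeff l j) * norm w ^ l * norm z ^ (j-1) \<le> 128^2 * (1/2)^n"
proof -
  have c: "norm (wz_coeff l j) \<le> 64 ^ n" using norm_wz_coeff_le[of l j] n by simp
  have e: "64^n * (1/128)^l * ((1/128)^2)^j = (1/2::real)^n"
  proof -
    have "a ^ (l + 2*j) * b ^ l * (b^2) ^ j = (a * b) ^ (l + 2*j)" for a b :: real
      by (simp add: power_mult_distrib power_add power_mult)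
    from this[of 64 "1/128"] show ?thesis by (simp add: n)
  qed
  have w': "norm w ^ l \<le> (1/128)^l" and z': "norm z ^ j \<le> ((1/128)^2)^j"
    using w z by (intro power_mono; simp)+
  have w'': "norm w ^ (l-1) \<le> 128 * (1/128)^l"
  proof (cases l)
    case (Suc m) then show ?thesis using power_mono[OF w, of m] by simp
  qed simp
  have z'': "norm z ^ (j-1) \<le> 128^2 * ((1/128)^2)^j"
  proof (cases j)
    case (Suc m) then show ?thesis using power_mono[OF z, of m] by (simp add: power2_eq_square[of "1/128"])
  qed simp
  define a b where "a = (1/128::real)^l" and "b = ((1/128::real)^2)^j"
  note e = e[folded a_def b_def] and bnds = c w'[folded a_def] z'[folded b_def]
    w''[folded a_def] z''[folded b_def]
  have "0 \<le> a" "0 \<le> b" by (simp_all add: a_def b_def)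
  have "norm (wz_coeff l j) * norm w ^ l * norm z ^ j \<le> 64^n * a * b"
    by (intro mult_mono bnds) (use \<open>0 \<le> a\<close> in auto)
  then show "norm (wz_coeff l j) * norm w ^ l * norm z ^ j \<le> (1/2)^n" unfolding e .
  have "norm (wz_coeff l j) * norm w ^ (l-1) * norm z ^ j \<le> 64^n * (128 * a) * b"
    by (intro mult_mono bnds) (use \<open>0 \<le> a\<close> in auto)
  also have "\<dots> = 128 * (64^n * a * b)" by simp
  finally show "norm (wz_coeff l j) * norm w ^ (l-1) * norm z ^ j \<le> 128 * (1/2)^n" unfolding e .
  have "norm (wz_coeff l j) * norm w ^ l * norm z ^ (j-1) \<le> 64^n * a * (128^2 * b)"
    by (intro mult_mono bnds) (use \<open>0 \<le> a\<close> in auto)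
  also have "\<dots> = 128^2 * (64^n * a * b)" by simp
  finally show "norm (wz_coeff l j) * norm w ^ l * norm z ^ (j-1) \<le> 128^2 * (1/2)^n" unfolding e .
qed

lemma norm_wz_part_le:
  assumes "norm w \<le> 1/128" "norm z \<le> (1/128)^2"
  shows "norm (wz_part 0 0 n w z) \<le> real (n+1) * (1/2)^n"
  unfolding wz_part_def
  by (rule norm_weight_sum_le) (simp add: norm_mult norm_power norm_term_le(1)[OF assms])

text \<open>Both sequences are O(n^3 2^(-n)) and start at 0, since the only monomial of weight 0 is
  constant.\<close>

lemma
  fixes w z :: complex
  assumes wz: "norm w \<le> 1/128" "norm z \<le> (1/128)^2"
  shows tele_w_sums: "(\<lambda>n. tele_w w z n - tele_w w z (Suc n)) sums 0"
    and tele_z_sums: "(\<lambda>n. tele_z w z n - tele_z w z (Suc n)) sums 0"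
proof -
  have "norm (tele_w w z n) \<le> 128 * real (n+1)^3 * (1/2)^n" for n
  proof -
    have "norm (tele_w w z n) \<le> real (n+1) * (real (n+1)^2 * (128 * (1/2)^n))"
      unfolding tele_w_eq
    proof (rule norm_weight_sum_le)
      fix l j assume n: "l + 2*j = n"
      have "(real l * real (j + l)) * (norm (wz_coeff l j) * norm w ^ (l-1) * norm z ^ j)
        \<le> real (n+1)^2 * (128 * (1/2)^n)"
        unfolding power2_eq_square
        by (intro mult_mono norm_term_le[OF wz n]) (use n in auto)
      then show "norm (of_nat l * of_nat (j + l) * wz_coeff l j * w ^ (l - 1) * z ^ j)
        \<le> real (n+1)^2 * (128 * (1/2)^n)"
        by (simp only: norm_mult norm_power norm_of_nat mult.assoc)
    qed
    then show ?thesis by (simp add: power2_eq_square power3_eq_cube ac_simps)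
  qed
  then have "tele_w w z \<longlonglongrightarrow> 0"
    by (intro Lim_null_comparison[OF _ tendsto_poly_times_power] always_eventually allI)
  then show "(\<lambda>n. tele_w w z n - tele_w w z (Suc n)) sums 0"
    using telescope_sums'[of "tele_w w z" 0] by (simp add: tele_w_eq weight_sum_def)
  have "norm (tele_z w z n) \<le> 128^2 * real (n+1)^3 * (1/2)^n" for n
  proof -
    have "norm (tele_z w z n) \<le> real (n+1) * (real (n+1)^2 * (128^2 * (1/2)^n))"
      unfolding tele_z_eq
    proof (rule norm_weight_sum_le)
      fix l j assume n: "l + 2*j = n"
      have "(real j^2) * (norm (wz_coeff l j) * norm w ^ l * norm z ^ (j-1))
        \<le> real (n+1)^2 * (128^2 * (1/2)^n)"
        by (intro mult_mono norm_term_le[OF wz n] power_mono) (use n in auto)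
      then show "norm (of_nat j^2 * wz_coeff l j * w ^ l * z ^ (j - 1))
        \<le> real (n+1)^2 * (128^2 * (1/2)^n)"
        by (simp only: norm_mult norm_power norm_of_nat mult.assoc)
    qed
    then show ?thesis by (simp add: power2_eq_square power3_eq_cube ac_simps)
  qed
  then have "tele_z w z \<longlonglongrightarrow> 0"
    by (intro Lim_null_comparison[OF _ tendsto_poly_times_power] always_eventually allI)
  then show "(\<lambda>n. tele_z w z n - tele_z w z (Suc n)) sums 0"
    using telescope_sums'[of "tele_z w z" 0] by (simp add: tele_z_eq weight_sum_def)
qed

lemma A_series_eq:
  assumes "y \<noteq> 0"
  shows "A_series x y = (\<Sum>n. wz_part 0 0 n (- x * y) (-(x^2)))"
proof -
  have "(\<Sum>k\<le>n. A_term x y n k) = wz_part 0 0 n (- x * y) (-(x^2))" for n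
  proof -
    have "(\<Sum>k\<le>n. A_term x y n k) = (\<Sum>j\<le>n. A_term x y n (n - j))"
      by (rule sum.reindex_bij_witness[of _ "\<lambda>j. n - j" "\<lambda>j. n - j"]) auto
    \<comment> \<open>For j > n div 2 the last binomial vanishes because 2k = 2 (n - j) < n; this
      also removes all negative exponents of y.\<close>
    also have "\<dots> = (\<Sum>j\<le>n div 2. A_term x y n (n - j))"
      by (rule sum.mono_neutral_right) (auto simp: A_term_def intro!: binomial_eq_0)
    also have "\<dots> = wz_part 0 0 n (- x * y) (-(x^2))"
      unfolding wz_part_def weight_sum_def
    proof (rule sum.cong)
      fix j assume j: "j \<in> {..n div 2}"
      define l where "l = n - 2*j"
      have n: "n = l + 2*j" "n - 2*j = l" using j by (auto simp: l_def)
      have k: "n - j = l + j" using n by simp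
      have "2 * int (l + j) - int (l + 2*j) = int l"
        "(l + 2*j) choose (l + j) = (l + 2*j) choose j"
        using binomial_symmetric[of j "l + 2*j"] by (simp_all add: add.commute[of j l])
      then have "A_term x y n (n - j) = x ^ (l + 2*j) * wz_coeff l j * (-1) ^ (l + j) * y ^ l"
        unfolding A_term_def k unfolding n(1) wz_coeff_binomial by (simp add: power_int_of_nat ac_simps)
      also have "\<dots> = wz_coeff l j * (- x * y) ^ l * (-(x^2)) ^ j"
        by (simp add: power_add power_mult power_mult_distrib power_minus[of x] power_minus[of "x^2"])
           (simp add: power_minus[of "x*y"] power_mult_distrib)
      finally show "A_term x y n (n - j) = wz_coeff (n - 2*j) j * monom_deriv 0 (n - 2*j) (- x * y) * monom_deriv 0 j (-(x^2))"
        using n by simp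
    qed simp
    finally show ?thesis .
  qed
  then show ?thesis unfolding A_series_def by simp
qed

section \<open>The double series along the curve\<close>

definition wpar :: "complex \<Rightarrow> complex \<Rightarrow> complex" where
  "wpar Y x = (x - Y)^2 / 16 / (1 + x*Y)^2"

text \<open>The factor x (1 - x^2), the leading coefficient of the differential equation, is kept
  together; up to powers of 1 + x Y, z is a constant multiple of it.\<close>

definition zpar :: "complex \<Rightarrow> complex \<Rightarrow> complex" where
  "zpar Y x = Y * (1 - Y^2) / 16 * (x * (1 - x^2)) / (1 + x*Y)^4"

lemma par_commute: "wpar Y X = wpar X Y" "zpar Y X = zpar X Y"
  unfolding wpar_def zpar_def by (simp_all add: mult.commute power2_commute mult.left_commute)

text \<open>The quotient rule in cancelled form: each differentiation raises the power of the
  denominator by one only, which keeps the later rational identities small.\<close>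

lemma has_field_derivative_divide_power:
  fixes P :: "complex \<Rightarrow> complex"
  assumes "(P has_field_derivative P') (at x)" "1 + x*Y \<noteq> 0"
  shows "((\<lambda>x. P x / (1 + x*Y)^k) has_field_derivative
    (P' * (1 + x*Y) - of_nat k * Y * P x) / (1 + x*Y)^(k+1)) (at x)"
proof (cases k)
  case 0
  then show ?thesis using assms by simp
next
  case (Suc m)
  show ?thesis unfolding Suc
    by (rule derivative_eq_intros assms refl | simp add: assms)+
       (use assms(2) in \<open>simp add: divide_simps, simp add: algebra_simps\<close>)
qed

text \<open>The left-hand side is the differential operator applied to G(w(X), z(X)) / D, with Tab standing
  for the partial derivatives of G. The multipliers \<open>\<alpha>\<close> and \<open>\<beta>\<close> are read off by comparing the
  coefficients of T00 and of T02.\<close>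

lemma elliptic_ode_identity:
  fixes Y X T00 T10 T01 T20 T11 T02 D p q c N N1 w z w1 z1 w2 z2 \<alpha> \<beta> :: complex
  assumes D_def: "D = 1 + X*Y"
    and p_def: "p = X * (1 - X^2)" and q_def: "q = 1 - 3 * X^2" and c_def: "c = Y * (1 - Y^2) / 16"
    and N_def: "N = q * D - 4 * Y * p" and N1_def: "N1 = - 6 * X * D - 3 * Y * q"
    and w_def: "w = (X - Y)^2 / 16 / D^2" and z_def: "z = c * p / D^4"
    and w1_def: "w1 = (1 + Y^2) * (X - Y) / 8 / D^3" and z1_def: "z1 = c * N / D^5"
    and w2_def: "w2 = (1 + Y^2) * (D - 3 * Y * (X - Y)) / 8 / D^4"
    and z2_def: "z2 = c * (N1 * D - 5 * Y * N) / D^6"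
    and \<alpha>_def: "\<alpha> = (X + Y) * (1 - X*Y) / 4 / D^3"
    and \<beta>_def: "\<beta> = Y * (1 - Y^2) * (1 + X^2)^2 / 16 / D^5"
    and D: "D \<noteq> 0"
  shows "p * (2 * Y^2 / D^3 * T00 - 2 * Y / D^2 * (w1 * T10 + z1 * T01)
        + (w2 * T10 + z2 * T01 + w1^2 * T20 + 2 * w1 * z1 * T11 + z1^2 * T02) / D)
      + q * (- Y / D^2 * T00 + (w1 * T10 + z1 * T01) / D) - X * (T00 / D)
    = \<alpha> * ((w * T20 + T10 + z * T11) - (32 * z^2 * T02 + 48 * w * z * T11 + 16 * w^2 * T20
        + 56 * z * T01 + 32 * w * T10 + 4 * T00))
      + \<beta> * ((z * T02 + T01) - (8 * z * T11 + 4 * w * T20 + 6 * T10))"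
proof -
  \<comment> \<open>These abbreviations stay atomic while denominators are cleared. All that depends
    on their definitions is isolated in the polynomial identities \<open>S\<close>,
    \<open>Q\<close>, \<open>P10\<close>, \<open>P20\<close>, \<open>P11\<close>.\<close>
  define S where "S = (X + Y) * (1 - X*Y)"
  define R where "R = (1 + X^2)^2"
  define k where "k = (1 + Y^2) * (X - Y)"
  define E where "E = (X - Y)^2"
  have c16: "16 * c = Y * (1 - Y^2)" by (simp add: c_def)
  have \<alpha>: "\<alpha> = S / 4 / D^3" by (simp add: \<alpha>_def S_def)
  have \<beta>: "\<beta> = c * R / D^5" by (simp add: \<beta>_def R_def c_def)
  have w: "w = E / 16 / D^2" by (simp add: w_def E_def)
  have w1: "w1 = k / 8 / D^3" by (simp add: w1_def k_def)
  have S: "2 * Y^2 * p - Y * q * D - X * D^2 = - S"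
    unfolding S_def p_def q_def D_def by (simp add: eval_nat_numeral algebra_simps)
  \<comment> \<open>Matching T02 with \<open>\<alpha>\<close> already known requires N^2 + 8 S p to
    be divisible by D^2; the quotient R = (1 + X^2)^2 is the source of
    \<open>\<beta>\<close>.\<close>
  have Q: "D^2 * R = N^2 + 8 * S * p"
    unfolding N_def D_def p_def q_def S_def R_def by (simp add: eval_nat_numeral algebra_simps)
  have P10: "- 4 * Y * p * k + 2 * p * (1 + Y^2) * (D - 3 * Y * (X - Y)) + 2 * q * k * D
      = 4 * S * (D^2 - 2 * E) - 6 * (16 * c) * R"
    unfolding D_def p_def q_def S_def R_def k_def E_def c16
    by (simp add: eval_nat_numeral algebra_simps)
  have P20: "p * k^2 = S * E * (D^2 - E) - (16 * c) * R * E"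
    unfolding D_def p_def S_def R_def k_def E_def c16
    by (simp add: eval_nat_numeral algebra_simps)
  have P11: "k * N = S * (D^2 - 3 * E) - 2 * (16 * c) * R"
    unfolding D_def p_def q_def N_def S_def R_def k_def E_def c16
    by (simp add: eval_nat_numeral algebra_simps)
  have 00: "p * (2 * Y^2 / D^3) - q * Y / D^2 - X / D = - 4 * \<alpha>"
  proof -
    have "p * (2 * Y^2 / D^3) - q * Y / D^2 - X / D = (2 * Y^2 * p - Y * q * D - X * D^2) / D^3"
      using D by (simp add: divide_simps eval_nat_numeral)
    then show ?thesis unfolding S \<alpha> by simp
  qed
  have 10: "- p * (2 * Y / D^2) * w1 + (p * w2 + q * w1) / D = \<alpha> * (1 - 32 * w) - 6 * \<beta>"
  proof -
    have "- p * (2 * Y / D^2) * w1 + (p * w2 + q * w1) / D =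
      (- 4 * Y * p * k + 2 * p * (1 + Y^2) * (D - 3 * Y * (X - Y)) + 2 * q * k * D) / 16 / D^5"
      unfolding w1 w2_def using D by (simp add: field_simps eval_nat_numeral)
    also have "\<dots> = \<alpha> * (1 - 32 * w) - 6 * \<beta>"
      unfolding P10 \<alpha> \<beta> w using D by (simp add: field_simps eval_nat_numeral)
    finally show ?thesis .
  qed
  have 01: "- p * (2 * Y / D^2) * z1 + (p * z2 + q * z1) / D = - 56 * \<alpha> * z + \<beta>"
  proof -
    have "- p * (2 * Y / D^2) * z1 + (p * z2 + q * z1) / D =
      c * (p * N1 * D - 7 * Y * p * N + q * N * D) / D^7"
      unfolding z1_def z2_def using D by (simp add: field_simps eval_nat_numeral)
    \<comment> \<open>This regrouping reduces T01 to the identities \<open>S\<close> and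
      \<open>Q\<close> of T00 and T02.\<close>
    also have "p * N1 * D - 7 * Y * p * N + q * N * D
      = 6 * p * (2 * Y^2 * p - Y * q * D - X * D^2) + N^2"
      unfolding N1_def N_def by (simp add: eval_nat_numeral algebra_simps)
    also have "\<dots> = D^2 * R - 14 * S * p" unfolding S Q by simp
    also have "c * (D^2 * R - 14 * S * p) / D^7 = - 56 * \<alpha> * z + \<beta>"
      unfolding \<alpha> \<beta> z_def using D by (simp add: field_simps eval_nat_numeral)
    finally show ?thesis .
  qed
  have 20: "p * w1^2 / D = \<alpha> * (w - 16 * w^2) - 4 * \<beta> * w"
  proof -
    have "p * w1^2 / D = (p * k^2) / 64 / D^7"
      unfolding w1 using D by (simp add: field_simps eval_nat_numeral)
    also have "\<dots> = \<alpha> * (w - 16 * w^2) - 4 * \<beta> * w"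
      unfolding P20 \<alpha> \<beta> w using D by (simp add: field_simps eval_nat_numeral)
    finally show ?thesis .
  qed
  have 11: "2 * p * w1 * z1 / D = z * (\<alpha> * (1 - 48 * w) - 8 * \<beta>)"
  proof -
    have "2 * p * w1 * z1 / D = c * p * (k * N) / 4 / D^9"
      unfolding w1 z1_def using D by (simp add: field_simps eval_nat_numeral)
    also have "\<dots> = z * (\<alpha> * (1 - 48 * w) - 8 * \<beta>)"
      unfolding P11 \<alpha> \<beta> w z_def using D by (simp add: field_simps eval_nat_numeral)
    finally show ?thesis .
  qed
  have 02: "p * z1^2 / D = z * (\<beta> - 32 * \<alpha> * z)"
  proof -
    have "p * z1^2 / D = c^2 * p * (D^2 * R - 8 * S * p) / D^11"
      unfolding z1_def Q using D by (simp add: field_simps eval_nat_numeral)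
    also have "\<dots> = z * (\<beta> - 32 * \<alpha> * z)"
      unfolding \<alpha> \<beta> z_def using D by (simp add: field_simps eval_nat_numeral)
    finally show ?thesis .
  qed
  have "p * (2 * Y^2 / D^3 * T00 - 2 * Y / D^2 * (w1 * T10 + z1 * T01)
        + (w2 * T10 + z2 * T01 + w1^2 * T20 + 2 * w1 * z1 * T11 + z1^2 * T02) / D)
      + q * (- Y / D^2 * T00 + (w1 * T10 + z1 * T01) / D) - X * (T00 / D)
    = (p * (2 * Y^2 / D^3) - q * Y / D^2 - X / D) * T00
      + (- p * (2 * Y / D^2) * w1 + (p * w2 + q * w1) / D) * T10
      + (- p * (2 * Y / D^2) * z1 + (p * z2 + q * z1) / D) * T01
      + (p * w1^2 / D) * T20 + (2 * p * w1 * z1 / D) * T11 + (p * z1^2 / D) * T02"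
    by (simp add: algebra_simps add_divide_distrib)
  also have "\<dots> = \<alpha> * ((w * T20 + T10 + z * T11) - (32 * z^2 * T02 + 48 * w * z * T11 + 16 * w^2 * T20
        + 56 * z * T01 + 32 * w * T10 + 4 * T00))
      + \<beta> * ((z * T02 + T01) - (8 * z * T11 + 4 * w * T20 + 6 * T10))"
    unfolding 00 10 01 20 11 02 by (simp add: algebra_simps power2_eq_square)
  finally show ?thesis .
qed

text \<open>The numerator of w is the square of X - Y, of norm at most 1/128, and z contains both 1
  - X^2 and 1 - Y^2, each of norm at most 3/256. Since 1 + X Y is near 2, the denominators only
  help.\<close>

lemma par_bounds:
  assumes "X \<in> ball 1 (1/256)" "Y \<in> ball 1 (1/256)"
  shows "norm (1 + X*Y) \<ge> 1" "norm (wpar Y X) \<le> 1/128" "norm (zpar Y X) \<le> (1/128)^2"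
proof -
  have near: "norm (t - 1) \<le> 1/256 \<and> norm t \<le> 2 \<and> norm (1 - t^2) \<le> 3/256"
    if "t \<in> ball 1 (1/256)" for t :: complex
  proof -
    have 1: "norm (t - 1) \<le> 1/256" using that by (simp add: dist_norm norm_minus_commute)
    moreover have "norm t \<le> norm (t - 1) + 1" "norm (1 + t) \<le> norm (t - 1) + 2"
      using norm_triangle_ineq[of "t - 1" 1] norm_triangle_ineq[of "t - 1" 2]
      by (simp_all add: add.commute)
    moreover have "norm (1 - t^2) = norm (t - 1) * norm (1 + t)"
      unfolding norm_mult[symmetric] norm_minus_commute[of 1]
      by (simp add: algebra_simps power2_eq_square)
    moreover from calculation have "norm (t - 1) * norm (1 + t) \<le> 1/256 * 3"
      by (intro mult_mono) auto
    ultimately show ?thesis by auto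
  qed
  note X = near[OF assms(1)] and Y = near[OF assms(2)]
  have "norm ((X - 1) * Y + (Y - 1)) \<le> 1/256 * 2 + 1/256"
    by (rule norm_triangle_le, unfold norm_mult, intro add_mono mult_mono) (use X Y in auto)
  moreover have "2 - norm ((X - 1) * Y + (Y - 1)) \<le> norm (1 + X*Y)"
    using norm_diff_ineq[of 2 "(X - 1) * Y + (Y - 1)"] by (simp add: algebra_simps)
  ultimately show D: "norm (1 + X*Y) \<ge> 1" by simp
  have "norm (X - Y) \<le> 1/128"
    using norm_triangle_ineq4[of "X - 1" "Y - 1"] X Y by simp
  then have "norm (X - Y)^2 \<le> (1/128)^2" by (intro power_mono) auto
  then have "norm (X - Y)^2 / 16 \<le> 1/128" by (simp add: power2_eq_square)
  then have "norm (X - Y)^2 / 16 / norm (1 + X*Y)^2 \<le> 1/128 / 1"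
    using D by (intro frac_le[OF _ _ zero_less_one]) (auto intro: one_le_power)
  then show "norm (wpar Y X) \<le> 1/128"
    unfolding wpar_def norm_divide norm_power by simp
  have "norm Y * norm (1 - Y^2) * (norm X * norm (1 - X^2)) \<le> 2 * (3/256) * (2 * (3/256))"
    using X Y by (intro mult_mono) auto
  then have "norm Y * norm (1 - Y^2) / 16 * (norm X * norm (1 - X^2)) \<le> (1/128)^2"
    by (simp add: power2_eq_square[of "1/128"] ac_simps)
  then have "norm Y * norm (1 - Y^2) / 16 * (norm X * norm (1 - X^2)) / norm (1 + X*Y)^4 \<le> (1/128)^2 / 1"
    using D by (intro frac_le[OF _ _ zero_less_one]) (auto intro: one_le_power)
  then show "norm (zpar Y X) \<le> (1/128)^2"
    unfolding zpar_def norm_divide norm_power norm_mult by simp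
qed

section \<open>Factorisation of the double series along the curve\<close>

definition prodfun :: "complex \<Rightarrow> complex \<Rightarrow> complex" where
  "prodfun Y x = (\<Sum>n. wz_part 0 0 n (wpar Y x) (zpar Y x) / (1 + x*Y))"

lemma elliptic_ode_on_prodfun:
  assumes Y: "Y \<in> ball 1 (1/256)"
  shows "elliptic_ode_on (ball 1 (1/256)) (prodfun Y)"
proof -
  define D p q where "D = (\<lambda>x. 1 + x*Y)" and "p = (\<lambda>x::complex. x * (1 - x^2))"
    and "q = (\<lambda>x::complex. 1 - 3 * x^2)"
  define c where "c = Y * (1 - Y^2) / 16"
  define N N1 where "N = (\<lambda>x. q x * D x - 4 * Y * p x)" and "N1 = (\<lambda>x. - 6 * x * D x - 3 * Y * q x)"
  define w1 z1 where "w1 = (\<lambda>x. (1 + Y^2) * (x - Y) / 8 / D x^3)" and "z1 = (\<lambda>x. c * N x / D x^5)"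
  define w2 z2 where "w2 = (\<lambda>x. (1 + Y^2) * (D x - 3 * Y * (x - Y)) / 8 / D x^4)"
    and "z2 = (\<lambda>x. c * (N1 x * D x - 5 * Y * N x) / D x^6)"
  define U where "U = (\<lambda>a b n x. wz_part a b n (wpar Y x) (zpar Y x))"
  define P1 where "P1 = (\<lambda>n x. w1 x * U 1 0 n x + z1 x * U 0 1 n x)"
  define P2 where "P2 = (\<lambda>n x. w2 x * U 1 0 n x + z2 x * U 0 1 n x + w1 x^2 * U 2 0 n x
      + 2 * w1 x * z1 x * U 1 1 n x + z1 x^2 * U 0 2 n x)"
  define f1 where "f1 = (\<lambda>n x. - Y / D x^2 * U 0 0 n x + P1 n x / D x)"
  define f2 where "f2 = (\<lambda>n x. 2 * Y^2 / D x^3 * U 0 0 n x - 2 * Y / D x^2 * P1 n x + P2 n x / D x)"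
  have quot: "((\<lambda>x. P x / D x^k) has_field_derivative
      (P' * D x - of_nat k * Y * P x) / D x^(k+1)) (at x)"
    if "(P has_field_derivative P') (at x)" "D x \<noteq> 0" for P P' x k
    using has_field_derivative_divide_power[of P P' x Y k] that by (simp add: D_def)
  have D0: "D x \<noteq> 0" if "x \<in> ball 1 (1/256)" for x
    using par_bounds(1)[OF that Y] by (auto simp: D_def)
  show ?thesis
    unfolding prodfun_def[abs_def]
  proof (rule elliptic_ode_on_suminf[where h = "\<lambda>n. real (n+1) * (1/2)^n" and ?f1.0 = f1 and ?f2.0 = f2])
    fix n :: nat and x :: complex assume x: "x \<in> ball 1 (1/256)"
    note D = D0[OF x]
    have dp: "(p has_field_derivative q x) (at x)" and dq: "(q has_field_derivative - 6 * x) (at x)"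
      unfolding p_def q_def
      by (auto intro!: derivative_eq_intros simp: algebra_simps power2_eq_square)
    have dD: "(D has_field_derivative Y) (at x)"
      unfolding D_def by (auto intro!: derivative_eq_intros)
    have dN: "(N has_field_derivative N1 x) (at x)"
      unfolding N_def N1_def
      by (rule derivative_eq_intros dp dq dD refl)+ (simp add: algebra_simps)
    have dw: "(wpar Y has_field_derivative w1 x) (at x)"
    proof -
      have *: "wpar Y = (\<lambda>x. (x - Y)^2 / 16 / D x^2)"
        by (simp add: fun_eq_iff wpar_def D_def)
      have P: "((\<lambda>x. (x - Y)^2 / 16) has_field_derivative (x - Y) / 8) (at x)"
        by (auto intro!: derivative_eq_intros)
      have num: "(x - Y) / 8 * D x - of_nat 2 * Y * ((x - Y)^2 / 16) = (1 + Y^2) * (x - Y) / 8"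
        by (simp add: D_def field_simps power2_eq_square)
      show ?thesis unfolding * w1_def using quot[OF P D, of 2] unfolding num by simp
    qed
    have dw1: "(w1 has_field_derivative w2 x) (at x)"
    proof -
      have P: "((\<lambda>x. (1 + Y^2) * (x - Y) / 8) has_field_derivative (1 + Y^2) / 8) (at x)"
        by (auto intro!: derivative_eq_intros)
      have num: "(1 + Y^2) / 8 * D x - of_nat 3 * Y * ((1 + Y^2) * (x - Y) / 8)
          = (1 + Y^2) * (D x - 3 * Y * (x - Y)) / 8"
        by (simp add: field_simps)
      show ?thesis unfolding w1_def w2_def using quot[OF P D, of 3] unfolding num by simp
    qed
    have dz: "(zpar Y has_field_derivative z1 x) (at x)"
    proof -
      have *: "zpar Y = (\<lambda>x. c * p x / D x^4)"
        by (simp add: fun_eq_iff zpar_def D_def p_def c_def)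
      have "((\<lambda>x. c * p x) has_field_derivative c * q x) (at x)"
        by (rule DERIV_cmult[OF dp])
      from quot[OF this D, of 4] show ?thesis unfolding *
        by (rule DERIV_cong) (simp add: z1_def N_def algebra_simps)
    qed
    have dz1: "(z1 has_field_derivative z2 x) (at x)"
    proof -
      have "((\<lambda>x. c * N x) has_field_derivative c * N1 x) (at x)"
        by (rule DERIV_cmult[OF dN])
      from quot[OF this D, of 5] show ?thesis unfolding z1_def
        by (rule DERIV_cong) (simp add: z2_def algebra_simps)
    qed
    have dU: "(U a b n has_field_derivative w1 x * U (Suc a) b n x + z1 x * U a (Suc b) n x) (at x)" for a b
      unfolding U_def by (rule has_field_derivative_wz_part[OF dw dz])
    have *: "(\<lambda>x. wz_part 0 0 n (wpar Y x) (zpar Y x) / (1 + x*Y)) = (\<lambda>x. U 0 0 n x / D x)"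
      by (simp add: U_def D_def)
    have dP0: "(U 0 0 n has_field_derivative P1 n x) (at x)"
      using dU[of 0 0] by (simp add: P1_def)
    have dP1: "(P1 n has_field_derivative P2 n x) (at x)"
      unfolding P1_def
      by (rule DERIV_cong[OF DERIV_add[OF DERIV_mult[OF dw1 dU] DERIV_mult[OF dz1 dU]]])
         (simp add: P2_def eval_nat_numeral algebra_simps)
    show "((\<lambda>x. wz_part 0 0 n (wpar Y x) (zpar Y x) / (1 + x*Y)) has_field_derivative f1 n x) (at x)"
      unfolding * using D
      by (intro DERIV_cong[OF DERIV_divide[OF dP0 dD]])
         (simp_all add: f1_def field_simps power2_eq_square)
    have "((\<lambda>x. - Y * (U 0 0 n x / D x^2) + P1 n x / D x^1) has_field_derivative
        - Y * ((P1 n x * D x - of_nat 2 * Y * U 0 0 n x) / D x^(2+1))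
        + (P2 n x * D x - of_nat 1 * Y * P1 n x) / D x^(1+1)) (at x)"
      by (intro DERIV_add DERIV_cmult quot dP0 dP1 D)
    then show "(f1 n has_field_derivative f2 n x) (at x)"
      unfolding f1_def f2_def
      by (rule DERIV_cong[OF _ _, THEN has_field_derivative_transform_within[OF _ zero_less_one]])
         (use D in \<open>simp_all add: field_simps eval_nat_numeral\<close>)
    show "norm (wz_part 0 0 n (wpar Y x) (zpar Y x) / (1 + x*Y)) \<le> real (n+1) * (1/2)^n"
      using frac_le[OF _ norm_wz_part_le[OF par_bounds(2,3)[OF x Y]] _ par_bounds(1)[OF x Y], of n]
      by (simp add: norm_divide)
  next
    fix x :: complex assume x: "x \<in> ball 1 (1/256)"
    note wz = par_bounds(2,3)[OF x Y]
    define \<alpha> where "\<alpha> = (x + Y) * (1 - x*Y) / 4 / D x^3"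
    define \<beta> where "\<beta> = Y * (1 - Y^2) * (1 + x^2)^2 / 16 / D x^5"
    let ?w = "wpar Y x" and ?z = "zpar Y x"
    \<comment> \<open>The parts of weight n and n + 1 of each telescoping sequence are both
      expressed through derivatives of the same weight n piece, so the rational identity applies to
      every n separately. The multipliers \<open>\<alpha>\<close>, \<open>\<beta>\<close> do not
      depend on n, so telescoping survives.\<close>
    have "p x * f2 n x + q x * f1 n x - x * (U 0 0 n x / D x) =
        \<alpha> * (tele_w ?w ?z n - tele_w ?w ?z (Suc n)) + \<beta> * (tele_z ?w ?z n - tele_z ?w ?z (Suc n))" for n
      unfolding f1_def f2_def P1_def P2_def tele_w_Suc tele_z_Suc
      unfolding tele_w_def tele_z_def U_def
      by (rule elliptic_ode_identity[OF _ _ _ c_def, where N = "N x" and ?N1.0 = "N1 x"],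
          unfold D_def p_def q_def N_def N1_def wpar_def zpar_def w1_def z1_def w2_def z2_def c_def
            \<alpha>_def \<beta>_def, (rule refl D0[OF x, unfolded D_def])+)
    moreover have "(\<lambda>n. \<alpha> * (tele_w ?w ?z n - tele_w ?w ?z (Suc n))
        + \<beta> * (tele_z ?w ?z n - tele_z ?w ?z (Suc n))) sums (\<alpha> * 0 + \<beta> * 0)"
      by (intro sums_add sums_mult tele_w_sums tele_z_sums wz)
    ultimately show "(\<lambda>n. x * (1 - x^2) * f2 n x + (1 - 3 * x^2) * f1 n x
        - x * (wz_part 0 0 n ?w ?z / (1 + x*Y))) sums 0"
      by (simp add: p_def q_def U_def D_def)
  qed (use summable_poly_times_power in simp_all)
qed

lemma prodfun_commute: "prodfun Y X = prodfun X Y"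
  unfolding prodfun_def par_commute[of Y X] by (simp add: mult.commute)

lemma prodfun_1_1: "prodfun 1 1 = 1/2"
proof -
  have "wz_part 0 0 n 0 0 = (if n = 0 then 1 else 0)" for n
  proof (cases "n = 0")
    case False
    then have "n - 2*j = 0 \<longrightarrow> j \<noteq> 0" for j by auto
    then have "wz_coeff (n - 2*j) j * monom_deriv 0 (n - 2*j) 0 * monom_deriv 0 j 0 = 0" for j by auto
    then show ?thesis using False unfolding wz_part_def weight_sum_def by simp
  qed (simp add: wz_part_def weight_sum_def wz_coeff_def)
  then have "prodfun 1 1 = (\<Sum>n. if n = 0 then 1/2 else 0)"
    unfolding prodfun_def wpar_def zpar_def by (auto intro!: suminf_cong)
  also have "\<dots> = 1/2" using suminf_finite[of "{0}" "\<lambda>n. if n = 0 then 1/2 else 0 :: complex"] by simp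
  finally show ?thesis .
qed

lemma hyp2F1_half_0: "hyp2F1 (1/2) (1/2) 1 0 = 1"
  unfolding hyp2F1_half by (simp add: ell_coeff_def)

text \<open>The radius is existential because proportionality divides by F, and F is known to be
  nonzero near 1 only through F(1) = 1 and continuity.\<close>

lemma prodfun_eq:
  obtains r where "r > 0" "r \<le> 1/256"
    "\<And>X Y. X \<in> ball 1 r \<Longrightarrow> Y \<in> ball 1 r \<Longrightarrow>
      prodfun Y X = hyp2F1 (1/2) (1/2) 1 (1 - X^2) * hyp2F1 (1/2) (1/2) 1 (1 - Y^2) / 2"
proof -
  define F where "F = (\<lambda>x. hyp2F1 (1/2) (1/2) 1 (1 - x^2))"
  have F1: "F 1 = 1" by (simp add: F_def hyp2F1_half_0)
  have ode: "elliptic_ode_on (ball 1 (1/256)) F"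
    unfolding F_def by (rule elliptic_ode_on_hyp2F1) auto
  then obtain d where "\<And>x. x \<in> ball 1 (1/256) \<Longrightarrow> (F has_field_derivative d x) (at x)"
    unfolding elliptic_ode_on_def by blast
  then have "(F has_field_derivative d 1) (at 1)" by simp
  then have "isCont F 1" by (rule DERIV_isCont)
  then obtain e where e: "e > 0" "\<And>x. dist 1 x < e \<Longrightarrow> F x \<noteq> 0"
    using continuous_at_avoid[of 1 F 0] F1 by auto
  define r where "r = min e (1/256)"
  have r: "r > 0" "r \<le> 1/256" "ball 1 r \<subseteq> ball (1::complex) (1/256)"
    using e by (auto simp: r_def)
  have nz: "F x \<noteq> 0" if "x \<in> ball 1 r" for x using e(2)[of x] that by (simp add: r_def)
  have out: "0 \<notin> ball (1::complex) r" "- 1 \<notin> ball (1::complex) r"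
    using r(2) by (auto simp: dist_norm)
  have scale: "prodfun Y X = prodfun Y 1 * F X" if "X \<in> ball 1 r" "Y \<in> ball 1 r" for X Y
  proof -
    have "prodfun Y X * F 1 = prodfun Y 1 * F X"
    proof (rule elliptic_ode_on_proportional[of "ball 1 r"])
      show "elliptic_ode_on (ball 1 r) (prodfun Y)"
        using elliptic_ode_on_subset[OF elliptic_ode_on_prodfun r(3)] that r(3) by blast
      show "elliptic_ode_on (ball 1 r) F" by (rule elliptic_ode_on_subset[OF ode r(3)])
    qed (use nz out r(1) that in auto)
    then show ?thesis by (simp add: F1)
  qed
  have "prodfun Y X = F X * F Y / 2" if XY: "X \<in> ball 1 r" "Y \<in> ball 1 r" for X Y
  proof -
    have "prodfun Y X = prodfun Y 1 * F X" by (rule scale[OF XY])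
    also have "prodfun Y 1 = prodfun 1 Y" by (rule prodfun_commute)
    also have "\<dots> = prodfun 1 1 * F Y" by (rule scale) (use XY r(1) in auto)
    finally show ?thesis by (simp add: prodfun_1_1)
  qed
  then show ?thesis using that[OF r(1,2)] unfolding F_def by blast
qed

section \<open>From the given relations between x, y, X, Y to the parameters w and z\<close>

theorem theorem2p3:
  shows "\<exists>U. open U \<and> (1::complex) \<in> U \<and>
    (\<forall>x y X Y. y \<noteq> 0 \<longrightarrow> A_abs_conv x y \<longrightarrow> X \<in> U \<longrightarrow> Y \<in> U \<longrightarrow> X \<noteq> Y \<longrightarrow>
       - x * y = ((X - Y) / (4 * (1 + X * Y)))^2 \<longrightarrow>
       1 + 4 * x / y = (((X + Y) * (1 - X * Y)) / ((X - Y) * (1 + X * Y)))^2 \<longrightarrow>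
       A_series x y = (1 + X * Y) / 2 * hyp2F1 (1/2) (1/2) 1 (1 - X^2) * hyp2F1 (1/2) (1/2) 1 (1 - Y^2))"
proof -
  obtain r where r: "r > 0" "r \<le> 1/256"
    "\<And>X Y. X \<in> ball 1 r \<Longrightarrow> Y \<in> ball 1 r \<Longrightarrow>
      prodfun Y X = hyp2F1 (1/2) (1/2) 1 (1 - X^2) * hyp2F1 (1/2) (1/2) 1 (1 - Y^2) / 2"
    using prodfun_eq by blast
  show ?thesis
  proof (intro exI[of _ "ball 1 r"] conjI allI impI)
    fix x y X Y :: complex
    assume y: "y \<noteq> 0" and XY: "X \<in> ball 1 r" "Y \<in> ball 1 r" "X \<noteq> Y"
      and xy: "- x * y = ((X - Y) / (4 * (1 + X * Y)))^2"
      and x_y: "1 + 4 * x / y = (((X + Y) * (1 - X * Y)) / ((X - Y) * (1 + X * Y)))^2"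
    have sub: "X \<in> ball 1 (1/256)" "Y \<in> ball 1 (1/256)" using XY r(2) by auto
    define D where "D = 1 + X * Y"
    have D: "D \<noteq> 0" using par_bounds(1)[OF sub] by (auto simp: D_def)
    have w: "- x * y = wpar Y X"
      unfolding xy wpar_def D_def[symmetric] by (simp add: power_divide power_mult_distrib)
    have z: "- (x^2) = zpar Y X"
    proof -
      \<comment> \<open>Multiplying - x y by 4 x / y eliminates y, so the two hypotheses together
        determine x^2.\<close>
      have "- 4 * x^2 = (- x * y) * ((1 + 4 * x / y) - 1)"
        using y by (simp add: power2_eq_square)
      also have "\<dots> = ((X - Y) / (4 * D))^2 * (((X + Y) * (1 - X * Y) / ((X - Y) * D))^2 - 1)"
        unfolding xy x_y D_def ..
      also have "\<dots> = (((X + Y) * (1 - X * Y))^2 - ((X - Y) * D)^2) / 16 / D^4"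
      proof -
        have "(b / (4 * D))^2 * ((a / (b * D))^2 - 1) = (a^2 - (b * D)^2) / 16 / D^4"
          if "b \<noteq> 0" for a b
          using D that by (simp add: field_simps eval_nat_numeral)
        then show ?thesis using XY(3) by simp
      qed
      \<comment> \<open>As a difference of squares the left side is the product of 2 Y (1 - X^2) and
        2 X (1 - Y^2).\<close>
      also have "((X + Y) * (1 - X * Y))^2 - ((X - Y) * D)^2 = 4 * (Y * (1 - Y^2) * (X * (1 - X^2)))"
        unfolding D_def by (simp add: eval_nat_numeral algebra_simps)
      finally have "4 * (- (x^2)) = 4 * zpar Y X"
        unfolding zpar_def D_def[symmetric] by (simp add: ac_simps)
      then show ?thesis by simp
    qed
    have "summable (\<lambda>n. wz_part 0 0 n (wpar Y X) (zpar Y X))"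
      by (rule summable_comparison_test'[OF summable_poly_times_power])
         (rule norm_wz_part_le[OF par_bounds(2,3)[OF sub]])
    then have "A_series x y = D * prodfun Y X"
      unfolding A_series_eq[OF y] w z prodfun_def D_def[symmetric]
      using D by (simp add: suminf_divide)
    then show "A_series x y = (1 + X * Y) / 2 * hyp2F1 (1/2) (1/2) 1 (1 - X^2)
        * hyp2F1 (1/2) (1/2) 1 (1 - Y^2)"
      unfolding r(3)[OF XY(1,2)] D_def by simp
  qed (use r(1) in auto)
qed

end
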